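(* Let $G$ be a locally compact group and $\phi:G\to G$ a continuous endomorphism. Then $H_{top}(\phi,U)=\mathbf H_{\mathfrak{lctop}}(\phi,U)$ for every $U\in\mathcal N(G)$, and so $h_{top}(\phi)=\mathbf h_{\mathfrak{lctop}}(\phi)$.
   Context: Groups are Hausdorff. $\mathcal N(G)$ is the family of all compact neighborhoods of $1$ in $G$, and $\mu$ is a right Haar measure on $G$. For $U\in\mathcal N(G)$ put $C_n(\phi,U)=U\cap\phi^{-1}(U)\cap\dots\cap\phi^{-n+1}(U)$, $H_{top}(\phi,U)=\limsup_{n\to\infty}-\frac{\log\mu(C_n(\phi,U))}{n}$ (independent of the choice of $\mu$) and $h_{top}(\phi)=\sup\{H_{top}(\phi,U):U\in\mathcal N(G)\}$. A normed semigroup is a semigroup $(S,\cdot)$ with a function $v:S\to\mathbb R_{\ge0}$; $\mathfrak S^*$ is the category of normed semigroups and all semigroup homomorphisms. For an endomorphism $\psi$ of $(S,v)$ in $\mathfrak S^*$, $T_n(\psi,x)=x\cdot\psi(x)\cdots\psi^{n-1}(x)$, $h_{\mathfrak S^*}(\psi,x)=\limsup_{n\to\infty}\frac{v(T_n(\psi,x))}{n}$ and $h_{\mathfrak S^*}(\psi)=\sup_{x\in S}h_{\mathfrak S^*}(\psi,x)$. $\mathcal V(G)$ is the family of all closed neighborhoods of $1$ in $G$, a semilattice under $\cap$, normed by $v_T(U)=-\log\mu(U)$ if $\mu(U)\le1$ and $v_T(U)=0$ otherwise (including $\mu(U)=\infty$). The contravariant functor $\mathfrak{lctop}$ from locally compact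 groups and continuous homomorphisms to $\mathfrak S^*$ sends $G$ to $(\mathcal V(G),\cap,v_T)$ and $\phi$ to $\phi_T:U\mapsto\phi^{-1}(U)$. For an endomorphism $\phi$, $\mathbf H_{\mathfrak{lctop}}(\phi,U)=h_{\mathfrak S^*}(\phi_T,U)$ for $U\in\mathcal V(G)$ and $\mathbf h_{\mathfrak{lctop}}(\phi)=h_{\mathfrak S^*}(\phi_T)$ (supremum over all $U\in\mathcal V(G)$). *)

theory Defs
  imports "HOL-Analysis.Analysis"
begin

text \<open>
  Topological groups are types of the library class \<open>topological_group_add\<close>, which does not assume
  commutativity: the group operation is written \<open>+\<close> and the neutral element \<open>0\<close>.
\<close>

subsection \<open>Haar measure and topological entropy\<close>

text \<open>
  A right Haar measure is a nonzero right-invariant Radon measure on the Borel sets: finite on compact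
  sets, outer regular on Borel sets and inner regular on open sets.
\<close>

definition right_haar_measure :: "'a::topological_group_add measure \<Rightarrow> bool" where
  "right_haar_measure M \<longleftrightarrow>
     sets M = sets borel \<and>
     emeasure M UNIV \<noteq> 0 \<and>
     (\<forall>K. compact K \<longrightarrow> emeasure M K < \<infinity>) \<and>
     (\<forall>A\<in>sets borel. emeasure M A = (INF V\<in>{V. open V \<and> A \<subseteq> V}. emeasure M V)) \<and>
     (\<forall>V. open V \<longrightarrow> emeasure M V = (SUP K\<in>{K. compact K \<and> K \<subseteq> V}. emeasure M K)) \<and>
     (\<forall>A\<in>sets borel. \<forall>g. emeasure M ((\<lambda>x. x + g) ` A) = emeasure M A)"

definition group_hom :: "('a::group_add \<Rightarrow> 'b::group_add) \<Rightarrow> bool" where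
  "group_hom \<phi> \<longleftrightarrow> (\<forall>x y. \<phi> (x + y) = \<phi> x + \<phi> y)"

text \<open>Neighborhoods need not be open.\<close>

definition compact_nhds :: "'a::topological_group_add set set" where
  "compact_nhds = {U. compact U \<and> 0 \<in> interior U}"

definition closed_nhds :: "'a::topological_group_add set set" where
  "closed_nhds = {U. closed U \<and> 0 \<in> interior U}"

definition cotrajectory :: "nat \<Rightarrow> ('a \<Rightarrow> 'a) \<Rightarrow> 'a set \<Rightarrow> 'a set" where
  "cotrajectory n \<phi> U = (\<Inter>i<n. (\<phi> ^^ i) -` U)"

text \<open>
  For \<open>U\<close> a compact neighborhood of \<open>0\<close>, \<open>n \<ge> 1\<close>, \<open>\<phi>\<close> a continuous endomorphism of a locally
  compact Hausdorff group and \<open>M\<close> a right Haar measure, the measure of \<open>cotrajectory n \<phi> U\<close> is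
  finite and positive, so that the conventions for \<open>measure\<close> (infinite measure) and \<open>ln 0\<close> play
  no role. The limit superior and the supremum are taken in the extended reals.
\<close>

definition H_top :: "'a::topological_group_add measure \<Rightarrow> ('a \<Rightarrow> 'a) \<Rightarrow> 'a set \<Rightarrow> ereal" where
  "H_top M \<phi> U =
     limsup (\<lambda>n. ereal (- ln (measure M (cotrajectory n \<phi> U)) / real n))"

definition h_top :: "'a::topological_group_add measure \<Rightarrow> ('a \<Rightarrow> 'a) \<Rightarrow> ereal" where
  "h_top M \<phi> = (SUP U\<in>compact_nhds. H_top M \<phi> U)"

subsection \<open>Normed semigroups\<close>

record 's normed_semigroup_data =
  ns_carrier :: "'s set"
  ns_mult :: "'s \<Rightarrow> 's \<Rightarrow> 's"
  ns_norm :: "'s \<Rightarrow> real"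

locale normed_semigroup =
  fixes S :: "'s normed_semigroup_data"
  assumes closed: "x \<in> ns_carrier S \<Longrightarrow> y \<in> ns_carrier S \<Longrightarrow> ns_mult S x y \<in> ns_carrier S"
    and assoc: "x \<in> ns_carrier S \<Longrightarrow> y \<in> ns_carrier S \<Longrightarrow> z \<in> ns_carrier S \<Longrightarrow>
      ns_mult S (ns_mult S x y) z = ns_mult S x (ns_mult S y z)"
    and norm_nonneg: "x \<in> ns_carrier S \<Longrightarrow> 0 \<le> ns_norm S x"

text \<open>Morphisms of the category are arbitrary semigroup homomorphisms; the norm is ignored.\<close>

definition ns_hom :: "'s normed_semigroup_data \<Rightarrow> 't normed_semigroup_data \<Rightarrow> ('s \<Rightarrow> 't) set" where
  "ns_hom S S' = {\<psi>. \<psi> ` ns_carrier S \<subseteq> ns_carrier S' \<and>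
     (\<forall>x\<in>ns_carrier S. \<forall>y\<in>ns_carrier S. \<psi> (ns_mult S x y) = ns_mult S' (\<psi> x) (\<psi> y))}"

text \<open>A semigroup has no neutral element, hence no empty product at \<open>n = 0\<close>.\<close>

fun ns_trajectory :: "'s normed_semigroup_data \<Rightarrow> nat \<Rightarrow> ('s \<Rightarrow> 's) \<Rightarrow> 's \<Rightarrow> 's" where
  "ns_trajectory S 0 \<psi> x = undefined"
| "ns_trajectory S (Suc 0) \<psi> x = x"
| "ns_trajectory S (Suc (Suc n)) \<psi> x =
     ns_mult S (ns_trajectory S (Suc n) \<psi> x) ((\<psi> ^^ Suc n) x)"

definition ns_entropy_at :: "'s normed_semigroup_data \<Rightarrow> ('s \<Rightarrow> 's) \<Rightarrow> 's \<Rightarrow> ereal" where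
  "ns_entropy_at S \<psi> x =
     limsup (\<lambda>n. ereal (ns_norm S (ns_trajectory S n \<psi> x) / real n))"

definition ns_entropy :: "'s normed_semigroup_data \<Rightarrow> ('s \<Rightarrow> 's) \<Rightarrow> ereal" where
  "ns_entropy S \<psi> = (SUP x\<in>ns_carrier S. ns_entropy_at S \<psi> x)"

subsection \<open>The functor from locally compact groups to normed semigroups\<close>

text \<open>
  The comparison with \<open>1\<close> uses the extended-valued \<open>emeasure\<close>, so sets of infinite measure get
  norm \<open>0\<close>.
\<close>

definition v_T :: "'a::topological_group_add measure \<Rightarrow> 'a set \<Rightarrow> real" where
  "v_T M U = (if emeasure M U \<le> 1 then - ln (measure M U) else 0)"

definition lctop :: "'a::topological_group_add measure \<Rightarrow> 'a set normed_semigroup_data" where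
  "lctop M = \<lparr> ns_carrier = closed_nhds, ns_mult = (\<inter>), ns_norm = v_T M \<rparr>"

definition lctop_map :: "('a \<Rightarrow> 'b) \<Rightarrow> 'b set \<Rightarrow> 'a set" where
  "lctop_map \<phi> U = \<phi> -` U"

definition H_lctop :: "'a::topological_group_add measure \<Rightarrow> ('a \<Rightarrow> 'a) \<Rightarrow> 'a set \<Rightarrow> ereal" where
  "H_lctop M \<phi> U = ns_entropy_at (lctop M) (lctop_map \<phi>) U"

definition h_lctop :: "'a::topological_group_add measure \<Rightarrow> ('a \<Rightarrow> 'a) \<Rightarrow> ereal" where
  "h_lctop M \<phi> = ns_entropy (lctop M) (lctop_map \<phi>)"

lemma normed_semigroup_lctop: "normed_semigroup (lctop M)"
proof
  fix x y z :: "'a set"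
  assume "x \<in> ns_carrier (lctop M)"
  show "0 \<le> ns_norm (lctop M) x"
  proof (cases "emeasure M x \<le> 1")
    case True
    then have m: "measure M x \<le> 1"
      by (simp add: measure_def enn2real_leI)
    have "ln (measure M x) \<le> 0"
    proof (cases "measure M x = 0")
      case False
      then show ?thesis using m by (simp add: order_less_le)
    qed simp
    with True show ?thesis by (simp add: lctop_def v_T_def)
  qed (simp add: lctop_def v_T_def)
qed (auto simp: lctop_def closed_nhds_def)

lemma lctop_map_in_ns_hom:
  fixes \<phi> :: "'a::topological_group_add \<Rightarrow> 'b::topological_group_add"
  assumes "group_hom \<phi>" "continuous_on UNIV \<phi>"
  shows "lctop_map \<phi> \<in> ns_hom (lctop M') (lctop M)"
proof -
  have "\<phi> 0 + \<phi> 0 = \<phi> 0 + 0"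
    using assms(1) unfolding group_hom_def by (metis add.right_neutral)
  then have 0: "\<phi> 0 = 0"
    by (simp only: add_left_cancel)
  have "0 \<in> interior (\<phi> -` U)" if "0 \<in> interior U" for U
  proof (rule interiorI)
    show "open (\<phi> -` interior U)"
      using assms(2) by (simp add: open_vimage)
  qed (use that 0 interior_subset in auto)
  moreover have "closed (\<phi> -` U)" if "closed U" for U
    using assms(2) that by (simp add: closed_vimage)
  ultimately show ?thesis
    by (auto simp: ns_hom_def lctop_def lctop_map_def closed_nhds_def)
qed

end

theory Submission
  imports Defs
begin

text \<open>
  For a compact neighborhood the cotrajectories have finite, decreasing measure. If some measure
  is at most 1, both limsup sequences eventually agree; otherwise the norms all vanish and
  \<open>- ln (measure M (cotrajectory n \<phi> U))\<close> stays between \<open>- ln (measure M U)\<close> and 0, so both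
  limits are 0. For the suprema, a closed neighborhood is intersected with a compact one. The norm is
  antitone on sets of positive measure, and neighborhoods of 0 have positive Haar measure.
\<close>

text \<open>Stated for \<open>Suc n\<close> because the empty product in a semigroup is
  \<open>undefined\<close>, whereas \<open>cotrajectory 0 \<phi> U\<close> is
  \<open>UNIV\<close>.\<close>

lemma ns_trajectory_lctop:
  "ns_trajectory (lctop M) (Suc n) (lctop_map \<phi>) U = cotrajectory (Suc n) \<phi> U"
proof (induction n)
  case 0
  show ?case by (simp add: cotrajectory_def lessThan_Suc)
next
  case (Suc n)
  \<comment> \<open>Preimages compose in reverse order; \<open>funpow_swap1\<close> absorbs this,
    since \<phi> commutes with its own powers.\<close>
  have pow: "(lctop_map \<phi> ^^ k) U = (\<phi> ^^ k) -` U" for k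
    by (induction k) (simp_all add: lctop_map_def funpow_swap1 vimage_def)
  have "ns_trajectory (lctop M) (Suc (Suc n)) (lctop_map \<phi>) U
      = cotrajectory (Suc n) \<phi> U \<inter> (\<phi> ^^ Suc n) -` U"
    unfolding ns_trajectory.simps Suc.IH pow by (simp add: lctop_def)
  also have "\<dots> = cotrajectory (Suc (Suc n)) \<phi> U"
    unfolding cotrajectory_def lessThan_Suc[of "Suc n"] by blast
  finally show ?case .
qed

text \<open>The two sequences can differ only at index 0, which the limsup ignores. Both entropies
  now involve the same cotrajectories and can be compared term by term.\<close>

lemma H_lctop_eq_limsup:
  "H_lctop M \<phi> U = limsup (\<lambda>n. ereal (v_T M (cotrajectory n \<phi> U) / real n))"
  unfolding H_lctop_def ns_entropy_at_def
proof (rule Limsup_eq)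
  show "\<forall>\<^sub>F n in sequentially.
      ereal (ns_norm (lctop M) (ns_trajectory (lctop M) n (lctop_map \<phi>) U) / real n)
        = ereal (v_T M (cotrajectory n \<phi> U) / real n)"
    using eventually_gt_at_top[of 0]
  proof eventually_elim
    case (elim n)
    then obtain m where "n = Suc m" by (cases n) auto
    then show ?case
      unfolding \<open>n = Suc m\<close> ns_trajectory_lctop by (simp add: lctop_def)
  qed
qed

lemma cotrajectory_antimono: "m \<le> n \<Longrightarrow> cotrajectory n \<phi> U \<subseteq> cotrajectory m \<phi> U"
  unfolding cotrajectory_def by (rule INF_superset_mono) auto

lemma cotrajectory_subset: "0 < n \<Longrightarrow> cotrajectory n \<phi> U \<subseteq> U"
  using cotrajectory_antimono[of 1 n \<phi> U] by (simp add: cotrajectory_def lessThan_Suc)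

lemma continuous_on_funpow:
  fixes f :: "'a::topological_space \<Rightarrow> 'a"
  assumes "continuous_on UNIV f"
  shows "continuous_on UNIV (f ^^ n)"
proof (induction n)
  case (Suc n)
  then show ?case
    using assms continuous_on_compose[of UNIV "f ^^ n" f] by (auto intro: continuous_on_subset simp: o_def)
qed (simp add: continuous_on_id id_def)

lemma closed_cotrajectory:
  assumes "continuous_on UNIV \<phi>" "closed U"
  shows "closed (cotrajectory n \<phi> U)"
  unfolding cotrajectory_def
  using assms by (intro closed_INT ballI closed_vimage continuous_on_funpow)

text \<open>All powers of \<phi> fix 0, so the preimages of \<open>interior U\<close> are finitely
  many open sets around 0, and so is their intersection.\<close>

lemma zero_in_interior_cotrajectory:
  assumes "continuous_on UNIV \<phi>" "\<phi> 0 = 0" "0 \<in> interior U"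
  shows "0 \<in> interior (cotrajectory n \<phi> U)"
proof (rule interiorI)
  have fix0: "(\<phi> ^^ i) 0 = 0" for i
    by (induction i) (simp_all add: assms(2))
  show "open (\<Inter>i<n. (\<phi> ^^ i) -` interior U)"
    using assms(1) by (intro open_INT ballI open_vimage continuous_on_funpow) auto
  show "0 \<in> (\<Inter>i<n. (\<phi> ^^ i) -` interior U)"
    using assms(3) fix0 by auto
  show "(\<Inter>i<n. (\<phi> ^^ i) -` interior U) \<subseteq> cotrajectory n \<phi> U"
    unfolding cotrajectory_def using interior_subset by fastforce
qed

lemma open_right_translation:
  fixes W :: "'a::topological_group_add set"
  assumes "open W"
  shows "open ((\<lambda>x. x + g) ` W)"
proof -
  have "(\<lambda>x. x + g) ` W = (\<lambda>x. x + - g) -` W"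
    by (force simp: image_iff add.assoc)
  moreover have "continuous_on UNIV (\<lambda>x::'a. x + - g)"
    by (intro continuous_intros)
  ultimately show ?thesis
    using assms open_vimage by metis
qed

lemma right_haar_measure_sets: "right_haar_measure M \<Longrightarrow> sets M = sets borel"
  by (simp add: right_haar_measure_def)

text \<open>If \<open>W\<close> were null, all its right translates would be null by invariance.
  Finitely many of them cover any given compact set, so compact sets would be null, and inner
  regularity on \<open>UNIV\<close> would make the whole measure zero.\<close>

lemma right_haar_measure_open_pos:
  assumes haar: "right_haar_measure M" and "open W" "0 \<in> W"
  shows "0 < emeasure M W"
proof (rule ccontr)
  assume "\<not> 0 < emeasure M W"
  then have "emeasure M W = 0" by simp
  then have null: "emeasure M ((\<lambda>x. x + g) ` W) = 0" for g
    using haar \<open>open W\<close> unfolding right_haar_measure_def by (metis borel_open)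
  have sets: "sets M = sets borel"
    using haar by (rule right_haar_measure_sets)
  have "emeasure M K = 0" if "compact K" for K
  proof -
    have "K \<subseteq> (\<Union>g\<in>K. (\<lambda>x. x + g) ` W)"
      using \<open>0 \<in> W\<close> by force
    then obtain F where F: "finite F" "K \<subseteq> (\<Union>g\<in>F. (\<lambda>x. x + g) ` W)"
      using compactE_image[OF \<open>compact K\<close>, of K "\<lambda>g. (\<lambda>x. x + g) ` W"]
        open_right_translation[OF \<open>open W\<close>] by metis
    have "(\<Union>g\<in>F. (\<lambda>x. x + g) ` W) \<in> null_sets M"
      using F(1) null sets \<open>open W\<close>
      by (intro null_sets_UN' countable_finite null_setsI) (auto intro: open_right_translation borel_open)
    then show ?thesis
      using F(2) by (metis emeasure_mono le_zero_eq null_setsD1 null_setsD2)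
  qed
  then have "(SUP K\<in>{K. compact K \<and> K \<subseteq> UNIV}. emeasure M K) = 0"
    by (intro SUP_eq_const) auto
  then show False
    using haar unfolding right_haar_measure_def by (metis open_UNIV)
qed

lemma right_haar_measure_nhd_pos:
  assumes haar: "right_haar_measure M" and "closed A" "0 \<in> interior A"
  shows "0 < emeasure M A"
proof -
  have "0 < emeasure M (interior A)"
    using assms by (intro right_haar_measure_open_pos) auto
  also have "\<dots> \<le> emeasure M A"
    using assms by (intro emeasure_mono) (auto simp: right_haar_measure_def interior_subset)
  finally show ?thesis .
qed

text \<open>Positivity of the smaller set keeps the convention \<open>ln 0 = 0\<close> out: a null
  \<open>B\<close> would have norm 0, possibly below that of \<open>A\<close>.\<close>

lemma v_T_antimono:
  assumes "A \<in> sets M" "B \<subseteq> A" "0 < emeasure M B"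
  shows "v_T M A \<le> v_T M B"
proof -
  have le: "emeasure M B \<le> emeasure M A"
    using assms by (intro emeasure_mono)
  \<comment> \<open>This settles the case where \<open>A\<close> has measure above 1 and hence norm
    0.\<close>
  have nonneg: "0 \<le> v_T M B"
    using ln_le_zero_iff[of "measure M B"] measure_nonneg[of M B]
    by (cases "measure M B = 0") (auto simp: v_T_def measure_def enn2real_leI less_le)
  show ?thesis
  proof (cases "emeasure M A \<le> 1")
    case True
    have fin: "emeasure M A < \<infinity>"
      using True by (metis ennreal_one_less_top infinity_ennreal_def order_le_less_trans)
    have "measure M B \<le> measure M A"
      using le fin by (simp add: measure_def enn2real_mono)
    moreover have "0 < measure M B"
      using assms(3) le fin by (auto simp: measure_def enn2real_positive_iff)
    ultimately show ?thesis
      using True le by (auto simp: v_T_def)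
  qed (use nonneg in \<open>simp add: v_T_def\<close>)
qed

lemma H_top_eq_H_lctop:
  fixes \<phi> :: "'a::{topological_group_add, t2_space} \<Rightarrow> 'a"
  assumes haar: "right_haar_measure \<mu>" and cont: "continuous_on UNIV \<phi>" and U: "compact U"
  shows "H_top \<mu> \<phi> U = H_lctop \<mu> \<phi> U"
proof -
  let ?C = "\<lambda>n. cotrajectory n \<phi> U"
  have sets: "sets \<mu> = sets borel" and fin: "emeasure \<mu> U < \<infinity>"
    using haar U by (simp_all add: right_haar_measure_def)
  have U_sets: "U \<in> sets \<mu>"
    using U sets by (simp add: borel_compact)
  have C_sets: "?C n \<in> sets \<mu>" for n
    using sets closed_cotrajectory[OF cont compact_imp_closed[OF U]] by auto
  have C_le: "emeasure \<mu> (?C n) \<le> emeasure \<mu> U" if "0 < n" for n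
    using cotrajectory_subset[OF that] U_sets by (rule emeasure_mono)
  show ?thesis
  proof (cases "\<exists>m. emeasure \<mu> (?C m) \<le> 1")
    case True
    then obtain m where m: "emeasure \<mu> (?C m) \<le> 1" by blast
    \<comment> \<open>From index \<open>m\<close> on, all cotrajectories have measure at most 1, so
      only the logarithmic branch of \<open>v_T\<close> occurs.\<close>
    have "v_T \<mu> (?C n) = - ln (measure \<mu> (?C n))" if "m \<le> n" for n
      using order_trans[OF emeasure_mono[OF cotrajectory_antimono[OF that] C_sets] m]
      by (simp add: v_T_def)
    then show ?thesis
      unfolding H_top_def H_lctop_eq_limsup
      by (intro Limsup_eq eventually_sequentiallyI[of m]) simp
  next
    case False
    then have big: "1 < emeasure \<mu> (?C n)" for n
      by (simp add: not_le)
    \<comment> \<open>Index 0 is excluded because \<open>?C 0\<close> is the whole group, whose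
      measure may be infinite.\<close>
    have bounds: "0 \<le> ln (measure \<mu> (?C n)) \<and> ln (measure \<mu> (?C n)) \<le> ln (measure \<mu> U)"
      if "0 < n" for n
    proof -
      have "emeasure \<mu> (?C n) < \<infinity>"
        using C_le[OF that] fin by (rule order_le_less_trans)
      then have "1 \<le> measure \<mu> (?C n)"
        using big[of n] by (metis enn2real_1 enn2real_mono infinity_ennreal_def less_imp_le measure_def)
      moreover have "measure \<mu> (?C n) \<le> measure \<mu> U"
        using C_le[OF that] fin by (simp add: measure_def enn2real_mono)
      ultimately show ?thesis by simp
    qed
    \<comment> \<open>The numerators are bounded, so division by \<open>n\<close> forces the limit
      0.\<close>
    have "(\<lambda>n. - ln (measure \<mu> (?C n)) / real n) \<longlonglongrightarrow> 0"
    proof (rule tendsto_sandwich)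
      show "\<forall>\<^sub>F n in sequentially. - ln (measure \<mu> U) / real n \<le> - ln (measure \<mu> (?C n)) / real n"
        using eventually_gt_at_top[of 0] by eventually_elim (simp add: bounds divide_right_mono)
      show "\<forall>\<^sub>F n in sequentially. - ln (measure \<mu> (?C n)) / real n \<le> 0"
        using eventually_gt_at_top[of 0] by eventually_elim (simp add: bounds)
    qed (rule lim_const_over_n tendsto_const)+
    then have "H_top \<mu> \<phi> U = 0"
      unfolding H_top_def by (intro lim_imp_Limsup) (auto simp: zero_ereal_def)
    moreover have "v_T \<mu> (?C n) = 0" for n
      using big[of n] by (simp add: v_T_def)
    then have "H_lctop \<mu> \<phi> U = 0"
      unfolding H_lctop_eq_limsup by (simp add: Limsup_const)
    ultimately show ?thesis by simp
  qed
qed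

text \<open>The inequality already holds term by term: cotrajectories of \<open>V\<close> lie in
  those of \<open>U\<close>, and as closed neighborhoods of 0 they have positive measure, as
  \<open>v_T_antimono\<close> requires.\<close>

lemma H_lctop_antimono:
  assumes haar: "right_haar_measure \<mu>" and cont: "continuous_on UNIV \<phi>" and "\<phi> 0 = 0"
    and "U \<in> closed_nhds" "V \<in> closed_nhds" "V \<subseteq> U"
  shows "H_lctop \<mu> \<phi> U \<le> H_lctop \<mu> \<phi> V"
  unfolding H_lctop_eq_limsup
proof (intro Limsup_mono always_eventually allI)
  fix n
  have "v_T \<mu> (cotrajectory n \<phi> U) \<le> v_T \<mu> (cotrajectory n \<phi> V)"
  proof (rule v_T_antimono)
    show "cotrajectory n \<phi> U \<in> sets \<mu>"
      using closed_cotrajectory[OF cont] \<open>U \<in> closed_nhds\<close> right_haar_measure_sets[OF haar]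
      by (auto simp: closed_nhds_def)
    show "cotrajectory n \<phi> V \<subseteq> cotrajectory n \<phi> U"
      unfolding cotrajectory_def using \<open>V \<subseteq> U\<close> by blast
    show "0 < emeasure \<mu> (cotrajectory n \<phi> V)"
      using assms
      by (intro right_haar_measure_nhd_pos closed_cotrajectory zero_in_interior_cotrajectory)
        (auto simp: closed_nhds_def)
  qed
  then show "ereal (v_T \<mu> (cotrajectory n \<phi> U) / real n)
      \<le> ereal (v_T \<mu> (cotrajectory n \<phi> V) / real n)"
    by (simp add: divide_right_mono)
qed

theorem theorem7p1:
  fixes \<phi> :: "'a::{topological_group_add, t2_space} \<Rightarrow> 'a"
    and \<mu> :: "'a measure"
  assumes "locally_compact_space (euclidean :: 'a topology)"
    and "right_haar_measure \<mu>"
    and "group_hom \<phi>"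
    and "continuous_on UNIV \<phi>"
  shows "(\<forall>U\<in>compact_nhds. H_top \<mu> \<phi> U = H_lctop \<mu> \<phi> U) \<and> h_top \<mu> \<phi> = h_lctop \<mu> \<phi>"
proof
  show eq: "\<forall>U\<in>compact_nhds. H_top \<mu> \<phi> U = H_lctop \<mu> \<phi> U"
    using assms by (auto simp: compact_nhds_def intro: H_top_eq_H_lctop)
  have "\<phi> 0 + \<phi> 0 = \<phi> 0 + 0"
    using assms(3) unfolding group_hom_def by (metis add.right_neutral)
  then have \<phi>0: "\<phi> 0 = 0"
    by (simp only: add_left_cancel)
  \<comment> \<open>Local compactness at 0 provides one compact neighborhood \<open>K\<close>, which
    serves for every closed neighborhood below.\<close>
  obtain W K :: "'a set" where WK: "open W" "compact K" "0 \<in> W" "W \<subseteq> K"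
    using assms(1) unfolding locally_compact_space_def by simp blast
  have "h_top \<mu> \<phi> = (SUP U\<in>compact_nhds. H_lctop \<mu> \<phi> U)"
    unfolding h_top_def using eq by (intro SUP_cong) auto
  also have "\<dots> = (SUP U\<in>closed_nhds. H_lctop \<mu> \<phi> U)"
  proof (rule antisym)
    \<comment> \<open>Compact sets are closed in a Hausdorff group, so this supremum runs over a
      smaller family.\<close>
    show "(SUP U\<in>compact_nhds. H_lctop \<mu> \<phi> U) \<le> (SUP U\<in>closed_nhds. H_lctop \<mu> \<phi> U)"
      by (rule SUP_subset_mono)
        (auto simp: compact_nhds_def closed_nhds_def intro: compact_imp_closed)
    show "(SUP U\<in>closed_nhds. H_lctop \<mu> \<phi> U) \<le> (SUP U\<in>compact_nhds. H_lctop \<mu> \<phi> U)"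
    proof (rule SUP_mono)
      fix U :: "'a set"
      assume U: "U \<in> closed_nhds"
      have "0 \<in> interior K"
        using WK by (intro interiorI[of W])
      \<comment> \<open>Shrinking \<open>U\<close> to \<open>U \<inter> K\<close> gains compactness
        and, by antitonicity, can only raise the entropy.\<close>
      then have UK: "U \<inter> K \<in> compact_nhds"
        using U WK(2) by (simp add: compact_nhds_def closed_nhds_def closed_Int_compact)
      then have "U \<inter> K \<in> closed_nhds"
        by (simp add: compact_nhds_def closed_nhds_def compact_imp_closed)
      then have "H_lctop \<mu> \<phi> U \<le> H_lctop \<mu> \<phi> (U \<inter> K)"
        using assms \<phi>0 U by (intro H_lctop_antimono) auto
      with UK show "\<exists>V\<in>compact_nhds. H_lctop \<mu> \<phi> U \<le> H_lctop \<mu> \<phi> V"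
        by blast
    qed
  qed
  also have "\<dots> = h_lctop \<mu> \<phi>"
    by (simp add: h_lctop_def ns_entropy_def H_lctop_def lctop_def)
  finally show "h_top \<mu> \<phi> = h_lctop \<mu> \<phi>" .
qed

end
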